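(* Let $X$ be a first countable and locally Hausdorff topological space such that $NH_X(X)$ is dense in $X$. Then $X$ is not quasi-countably compact.
   Context: A space is locally Hausdorff if each point has a Hausdorff neighborhood. Two points can be separated if there are disjoint open sets containing one point each. For $x\in X$, $NH(x)$ is the set of points $y\neq x$ of $X$ which cannot be separated from $x$ by open sets, and $NH_X(X)=\{y\in X : \text{there is } x\in X \text{ with } y\in NH(x)\}=\{x\in X : NH(x)\neq\varnothing\}$. A space is quasi-countably compact if every countable open cover of it has a finite subcover (no Hausdorffness assumed).
   Formalization: The space X is assumed to be nonempty; the empty space satisfies every hypothesis (its empty set NH_X(X) is dense in it) but is quasi-countably compact, so the statement fails for it. *)

theory Defs
  imports "HOL-Analysis.Analysis"
begin

text \<open>Neighborhoods need not be open.\<close>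

definition locally_Hausdorff_space :: "'a topology \<Rightarrow> bool" where
  "locally_Hausdorff_space X \<longleftrightarrow>
     (\<forall>x \<in> topspace X. \<exists>U N. openin X U \<and> x \<in> U \<and> U \<subseteq> N \<and> N \<subseteq> topspace X \<and>
        Hausdorff_space (subtopology X N))"

definition separated_points :: "'a topology \<Rightarrow> 'a \<Rightarrow> 'a \<Rightarrow> bool" where
  "separated_points X x y \<longleftrightarrow>
     (\<exists>U V. openin X U \<and> openin X V \<and> x \<in> U \<and> y \<in> V \<and> disjnt U V)"

definition NH :: "'a topology \<Rightarrow> 'a \<Rightarrow> 'a set" where
  "NH X x = {y \<in> topspace X. y \<noteq> x \<and> \<not> separated_points X x y}"

definition NH_set :: "'a topology \<Rightarrow> 'a set" where
  "NH_set X = {y \<in> topspace X. \<exists>x \<in> topspace X. y \<in> NH X x}"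

definition quasi_countably_compact_space :: "'a topology \<Rightarrow> bool" where
  "quasi_countably_compact_space X \<longleftrightarrow>
     (\<forall>\<U>. countable \<U> \<and> (\<forall>U \<in> \<U>. openin X U) \<and> topspace X \<subseteq> \<Union>\<U>
        \<longrightarrow> (\<exists>\<F>. finite \<F> \<and> \<F> \<subseteq> \<U> \<and> topspace X \<subseteq> \<Union>\<F>))"

lemma separated_points_sym: "separated_points X x y \<longleftrightarrow> separated_points X y x"
  unfolding separated_points_def by (meson disjnt_sym)

lemma NH_sym:
  assumes "x \<in> topspace X" "y \<in> NH X x"
  shows "x \<in> NH X y"
  using assms unfolding NH_def by (auto simp: separated_points_sym[of X y x])

lemma NH_subset: "NH X x \<subseteq> topspace X"
  unfolding NH_def by (rule Collect_restrict)

lemma NH_set_eq: "NH_set X = {x \<in> topspace X. NH X x \<noteq> {}}"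
proof (intro equalityI subsetI)
  fix y assume "y \<in> NH_set X"
  then obtain x where "y \<in> topspace X" "x \<in> topspace X" "y \<in> NH X x"
    unfolding NH_set_def by blast
  with NH_sym[of x X y] show "y \<in> {x \<in> topspace X. NH X x \<noteq> {}}"
    by blast
next
  fix x assume "x \<in> {x \<in> topspace X. NH X x \<noteq> {}}"
  then obtain y where "x \<in> topspace X" "y \<in> NH X x"
    by blast
  moreover from this have "y \<in> topspace X" "x \<in> NH X y"
    using NH_subset[of X x] NH_sym[of x X y] by blast+
  ultimately show "x \<in> NH_set X"
    unfolding NH_set_def by blast
qed

end

theory Submission
  imports Defs
begin

text \<open>
  Call a set of points jointly nonseparated if arbitrary open neighbourhoods of its points always
  have a common point. In a quasi-countably compact space satisfying the hypotheses, every finite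
  jointly nonseparated set \<open>F\<close> can be enlarged. Indeed, first countability provides open sets
  \<open>C\<^sub>0 \<supseteq> C\<^sub>1 \<supseteq> \<dots>\<close>, each the intersection of Hausdorff neighbourhoods of the points of
  \<open>F\<close>, that eventually enter every choice of neighbourhoods of these points. They are nonempty, so by
  density \<open>C\<^sub>n\<close> contains some \<open>x\<^sub>n\<close> that cannot be separated from some \<open>y\<^sub>n\<close>. By compactness the
  \<open>y\<^sub>n\<close> have a cluster point \<open>z\<close>. Every neighbourhood of \<open>z\<close> meets \<open>C\<^sub>n\<close> for
  arbitrarily large \<open>n\<close>, so \<open>F\<close> together with \<open>z\<close> is again jointly nonseparated. And \<open>z\<close> is new: a
  Hausdorff neighbourhood of a point of \<open>F\<close> that contains every \<open>x\<^sub>n\<close> can contain no \<open>y\<^sub>n\<close>.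

  Starting from the empty set this yields an infinite set of pairwise nonseparated points. By
  compactness it accumulates at some point, and a Hausdorff neighbourhood of that point then contains
  two distinct points of the set, which it separates: a contradiction.
\<close>

section \<open>Cluster points and neighbourhood bases\<close>

text \<open>
  The open sets avoided by the tail of the sequence from index \<open>n\<close> on have a union that increases
  with \<open>n\<close>. Without a cluster point these countably many unions cover the space, so one of them is
  the whole space, although it misses the \<open>n\<close>-th term.
\<close>

lemma quasi_countably_compact_cluster_point:
  fixes y :: "nat \<Rightarrow> 'a"
  assumes "quasi_countably_compact_space X" and y: "range y \<subseteq> topspace X"
  shows "\<exists>z\<in>topspace X. \<forall>U N. openin X U \<and> z \<in> U \<longrightarrow> (\<exists>n\<ge>N. y n \<in> U)"
proof (rule ccontr)
  assume no_cluster: "\<not> ?thesis"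
  define A where "A N = \<Union>{U. openin X U \<and> (\<forall>n\<ge>N. y n \<notin> U)}" for N
  have "countable (range A)" by simp
  moreover have "\<forall>U\<in>range A. openin X U"
    unfolding A_def by blast
  moreover have "topspace X \<subseteq> \<Union>(range A)"
  proof
    fix z assume "z \<in> topspace X"
    then obtain U N where "openin X U" "z \<in> U" "\<forall>n\<ge>N. y n \<notin> U"
      using no_cluster by meson
    then show "z \<in> \<Union>(range A)"
      unfolding A_def by blast
  qed
  ultimately obtain \<F> where "finite \<F>" "\<F> \<subseteq> range A" and cover: "topspace X \<subseteq> \<Union>\<F>"
    using assms(1) unfolding quasi_countably_compact_space_def by meson
  then obtain I where I: "finite I" "\<F> = A ` I"
    by (meson finite_subset_image)
  obtain i where "i \<in> I" "y (Max I) \<in> A i"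
    using y cover I by blast
  moreover have "i \<le> Max I"
    using I \<open>i \<in> I\<close> by simp
  ultimately show False
    unfolding A_def by blast
qed

lemma first_countable_decreasing_neighbourhood_base:
  assumes "first_countable X" and x: "x \<in> topspace X"
  obtains B :: "nat \<Rightarrow> 'a set"
  where "\<And>n. openin X (B n)" and "\<And>n. x \<in> B n" and "decseq B"
    and "\<And>U. \<lbrakk>openin X U; x \<in> U\<rbrakk> \<Longrightarrow> \<exists>n. B n \<subseteq> U"
proof -
  obtain \<B> where "countable \<B>" and op: "\<forall>V\<in>\<B>. openin X V"
    and base: "\<And>U. \<lbrakk>openin X U; x \<in> U\<rbrakk> \<Longrightarrow> \<exists>V\<in>\<B>. x \<in> V \<and> V \<subseteq> U"
    using assms unfolding first_countable_def by meson
  define \<B>' where "\<B>' = {V\<in>\<B>. x \<in> V}"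
  have "countable \<B>'"
    unfolding \<B>'_def using \<open>countable \<B>\<close> by simp
  moreover have "\<B>' \<noteq> {}"
    using base[of "topspace X"] x unfolding \<B>'_def by auto
  ultimately obtain V :: "nat \<Rightarrow> 'a set" where V: "range V = \<B>'"
    by (metis range_from_nat_into)
  have V_mem: "openin X (V n)" "x \<in> V n" for n
    using op V unfolding \<B>'_def by blast+
  show thesis
  proof
    show "openin X (\<Inter>i\<le>n. V i)" for n
      by (rule openin_INT2) (auto simp: V_mem)
    show "x \<in> (\<Inter>i\<le>n. V i)" for n
      using V_mem by blast
    show "decseq (\<lambda>n. \<Inter>i\<le>n. V i)"
      unfolding decseq_def by auto
    show "\<exists>n. (\<Inter>i\<le>n. V i) \<subseteq> U" if U: "openin X U" "x \<in> U" for U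
    proof -
      obtain W where "W \<in> \<B>'" "W \<subseteq> U"
        using base[OF U] unfolding \<B>'_def by blast
      with V show ?thesis by blast
    qed
  qed
qed

section \<open>Hausdorff neighbourhoods\<close>

lemma locally_Hausdorff_open_neighbourhood:
  assumes "locally_Hausdorff_space X" and "x \<in> topspace X"
  obtains U where "openin X U" and "x \<in> U" and "Hausdorff_space (subtopology X U)"
proof -
  obtain U N where "openin X U" "x \<in> U" "U \<subseteq> N" "Hausdorff_space (subtopology X N)"
    using assms unfolding locally_Hausdorff_space_def by meson
  moreover from this have "Hausdorff_space (subtopology X U)"
    using Hausdorff_space_subtopology[of "subtopology X N" U]
    by (simp add: subtopology_subtopology Int_absorb1)
  ultimately show thesis using that by blast
qed

lemma separated_points_in_open_Hausdorff:
  assumes U: "openin X U" and "Hausdorff_space (subtopology X U)"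
    and "x \<in> U" "y \<in> U" "x \<noteq> y"
  shows "separated_points X x y"
proof -
  have "x \<in> topspace (subtopology X U)" "y \<in> topspace (subtopology X U)"
    using assms openin_subset[OF U] by auto
  then obtain V W where "openin (subtopology X U) V" "openin (subtopology X U) W"
      "x \<in> V" "y \<in> W" "disjnt V W"
    using assms unfolding Hausdorff_space_def by meson
  then show ?thesis
    unfolding separated_points_def using openin_open_subtopology[OF U] by blast
qed

section \<open>Jointly nonseparated sets\<close>

text \<open>
  The factor \<open>topspace X\<close> gives the empty set its intended meaning: it is jointly nonseparated
  precisely in a nonempty space.
\<close>

definition jointly_nonseparated :: "'a topology \<Rightarrow> 'a set \<Rightarrow> bool" where
  "jointly_nonseparated X F \<longleftrightarrow>
     (\<forall>U. (\<forall>z\<in>F. openin X (U z) \<and> z \<in> U z) \<longrightarrow> topspace X \<inter> (\<Inter>z\<in>F. U z) \<noteq> {})"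

lemma jointly_nonseparated_imp_not_separated:
  assumes F: "jointly_nonseparated X F" and "F \<subseteq> topspace X"
    and "x \<in> F" "y \<in> F" "x \<noteq> y"
  shows "\<not> separated_points X x y"
proof
  assume "separated_points X x y"
  then obtain V W where VW: "openin X V" "openin X W" "x \<in> V" "y \<in> W" "disjnt V W"
    unfolding separated_points_def by blast
  define U where "U z = (if z = x then V else if z = y then W else topspace X)" for z
  have "\<forall>z\<in>F. openin X (U z) \<and> z \<in> U z"
    unfolding U_def using VW assms by auto
  then have "topspace X \<inter> (\<Inter>z\<in>F. U z) \<noteq> {}"
    using F unfolding jointly_nonseparated_def by blast
  moreover have "(\<Inter>z\<in>F. U z) \<subseteq> U x \<inter> U y"
    using assms by blast
  moreover have "U x \<inter> U y = {}"
    using VW \<open>x \<noteq> y\<close> unfolding U_def disjnt_def by auto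
  ultimately show False by blast
qed

text \<open>
  The new point is a cluster point of partners of points taken ever closer to all of \<open>F\<close> at once.
  The common neighbourhoods are cut down to lie in fixed Hausdorff neighbourhoods of the points of
  \<open>F\<close>, which therefore miss all the partners; this is what keeps the cluster point outside \<open>F\<close>.
\<close>

lemma jointly_nonseparated_extend:
  assumes qcc: "quasi_countably_compact_space X" and fc: "first_countable X"
    and lH: "locally_Hausdorff_space X" and dense: "X closure_of (NH_set X) = topspace X"
    and "finite F" and F: "F \<subseteq> topspace X" and joint: "jointly_nonseparated X F"
  obtains z where "z \<in> topspace X" and "z \<notin> F" and "jointly_nonseparated X (insert z F)"
proof -
  have "\<forall>z\<in>F. \<exists>H. openin X H \<and> z \<in> H \<and> Hausdorff_space (subtopology X H)"
    using locally_Hausdorff_open_neighbourhood[OF lH] F by (metis subsetD)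
  then obtain H where H: "\<And>z. z \<in> F \<Longrightarrow> openin X (H z)" "\<And>z. z \<in> F \<Longrightarrow> z \<in> H z"
      "\<And>z. z \<in> F \<Longrightarrow> Hausdorff_space (subtopology X (H z))"
    by metis
  have "\<forall>z\<in>F. \<exists>B::nat \<Rightarrow> 'a set. (\<forall>n. openin X (B n) \<and> z \<in> B n) \<and> decseq B \<and>
          (\<forall>U. openin X U \<and> z \<in> U \<longrightarrow> (\<exists>n. B n \<subseteq> U))"
  proof
    fix z assume "z \<in> F"
    then have "z \<in> topspace X" using F by blast
    then obtain B :: "nat \<Rightarrow> 'a set" where "\<And>n. openin X (B n)" "\<And>n. z \<in> B n" "decseq B"
        "\<And>U. \<lbrakk>openin X U; z \<in> U\<rbrakk> \<Longrightarrow> \<exists>n. B n \<subseteq> U"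
      using first_countable_decreasing_neighbourhood_base[OF fc] by blast
    then show "\<exists>B::nat \<Rightarrow> 'a set. (\<forall>n. openin X (B n) \<and> z \<in> B n) \<and> decseq B \<and>
          (\<forall>U. openin X U \<and> z \<in> U \<longrightarrow> (\<exists>n. B n \<subseteq> U))"
      by blast
  qed
  then obtain B :: "'a \<Rightarrow> nat \<Rightarrow> 'a set"
    where B: "\<And>z n. z \<in> F \<Longrightarrow> openin X (B z n)" "\<And>z n. z \<in> F \<Longrightarrow> z \<in> B z n"
      "\<And>z. z \<in> F \<Longrightarrow> decseq (B z)"
      "\<And>z U. \<lbrakk>z \<in> F; openin X U; z \<in> U\<rbrakk> \<Longrightarrow> \<exists>n. B z n \<subseteq> U"
    by metis
  define C where "C n = topspace X \<inter> (\<Inter>z\<in>F. B z n \<inter> H z)" for n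
  have C_open: "openin X (C n)" for n
    unfolding C_def Int_commute[of "topspace X"]
    using \<open>finite F\<close> B H by (intro openin_INT openin_Int) auto
  have C_nonempty: "C n \<noteq> {}" for n
  proof -
    have "\<forall>z\<in>F. openin X (B z n \<inter> H z) \<and> z \<in> B z n \<inter> H z"
      using B H by auto
    then show ?thesis
      using joint[unfolded jointly_nonseparated_def, rule_format, of "\<lambda>z. B z n \<inter> H z"]
      unfolding C_def by blast
  qed
  have "\<exists>x y. x \<in> C n \<and> y \<in> topspace X \<and> y \<in> NH X x" for n
  proof -
    have "NH_set X \<inter> C n \<noteq> {}"
      using dense C_nonempty[of n] C_open[of n] openin_subset[OF C_open[of n]]
      by (metis Int_absorb1 Int_commute openin_Int_closure_of_eq_empty)
    then show ?thesis
      using NH_subset[of X] unfolding NH_set_eq by blast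
  qed
  then obtain x y where xC: "\<And>n. x n \<in> C n" and y: "\<And>n. y n \<in> topspace X"
      and xy: "\<And>n. y n \<in> NH X (x n)"
    by metis
  have y_notin: "y n \<notin> H w" if "w \<in> F" for n w
  proof
    assume "y n \<in> H w"
    moreover have "x n \<in> H w" using xC that unfolding C_def by blast
    moreover have "x n \<noteq> y n" "\<not> separated_points X (x n) (y n)"
      using xy[of n] unfolding NH_def by auto
    ultimately show False
      using separated_points_in_open_Hausdorff H that by metis
  qed
  obtain z where z: "z \<in> topspace X"
    and cluster: "\<And>U N. \<lbrakk>openin X U; z \<in> U\<rbrakk> \<Longrightarrow> \<exists>n\<ge>N. y n \<in> U"
    using quasi_countably_compact_cluster_point[OF qcc, of y] y by (metis image_subsetI)
  have "z \<notin> F"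
    using cluster H(1,2) y_notin by metis
  moreover have "jointly_nonseparated X (insert z F)"
    unfolding jointly_nonseparated_def
  proof (intro allI impI)
    fix U assume U: "\<forall>w\<in>insert z F. openin X (U w) \<and> w \<in> U w"
    then have "\<forall>w\<in>F. \<exists>n. B w n \<subseteq> U w"
      using B(4) by simp
    then obtain k where k: "\<And>w. w \<in> F \<Longrightarrow> B w (k w) \<subseteq> U w"
      by metis
    \<comment> \<open>The index 0 keeps the maximum meaningful when \<open>F\<close> is empty.\<close>
    define N where "N = Max (insert 0 (k ` F))"
    obtain n where n: "n \<ge> N" "y n \<in> U z"
      using cluster[of "U z" N] U by auto
    have "C n \<subseteq> U w" if "w \<in> F" for w
    proof -
      have "k w \<le> n"
        using n that \<open>finite F\<close> unfolding N_def by simp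
      then have "B w n \<subseteq> B w (k w)"
        using B(3)[OF that] unfolding decseq_def by blast
      then show ?thesis
        using k that unfolding C_def by blast
    qed
    moreover have "C n \<inter> U z \<noteq> {}"
      using xy[of n] xC[of n] n(2) C_open[of n] U
      unfolding NH_def separated_points_def disjnt_def by blast
    moreover have "C n \<subseteq> topspace X"
      unfolding C_def by blast
    ultimately show "topspace X \<inter> (\<Inter>w\<in>insert z F. U w) \<noteq> {}"
      by blast
  qed
  ultimately show thesis using that z by blast
qed

text \<open>
  Otherwise a Hausdorff neighbourhood of an accumulation point would contain two distinct points
  of the set.
\<close>

lemma pairwise_nonseparated_finite:
  assumes qcc: "quasi_countably_compact_space X" and lH: "locally_Hausdorff_space X"
    and S: "S \<subseteq> topspace X"
    and nonsep: "pairwise (\<lambda>x y. \<not> separated_points X x y) S"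
  shows "finite S"
proof (rule ccontr)
  assume "infinite S"
  then obtain s :: "nat \<Rightarrow> 'a" where "inj s" and s: "range s \<subseteq> S"
    using infinite_countable_subset by blast
  obtain z where z: "z \<in> topspace X"
    and cluster: "\<And>U N. \<lbrakk>openin X U; z \<in> U\<rbrakk> \<Longrightarrow> \<exists>n\<ge>N. s n \<in> U"
    using quasi_countably_compact_cluster_point[OF qcc, of s] s S by (metis subset_trans)
  obtain U where U: "openin X U" "z \<in> U" "Hausdorff_space (subtopology X U)"
    using locally_Hausdorff_open_neighbourhood[OF lH z] by blast
  obtain m where m: "s m \<in> U"
    using cluster[OF U(1,2)] by blast
  obtain n where n: "n \<ge> Suc m" "s n \<in> U"
    using cluster[OF U(1,2)] by blast
  have "s m \<noteq> s n"
    using \<open>inj s\<close> n unfolding inj_def by (metis Suc_n_not_le_n)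
  then show False
    using separated_points_in_open_Hausdorff[OF U(1,3) m n(2)] nonsep s
    unfolding pairwise_def by blast
qed

theorem theorem6p1:
  fixes X :: "'a topology"
  assumes "topspace X \<noteq> {}"
    and "first_countable X"
    and "locally_Hausdorff_space X"
    and "X closure_of (NH_set X) = topspace X"
  shows "\<not> quasi_countably_compact_space X"
proof
  assume qcc: "quasi_countably_compact_space X"
  let ?P = "\<lambda>F. finite F \<and> F \<subseteq> topspace X \<and> jointly_nonseparated X F"
  have "?P {}"
    using assms(1) by (simp add: jointly_nonseparated_def)
  moreover have "\<exists>F'. ?P F' \<and> F \<subset> F'" if F: "?P F" for F
  proof -
    obtain z where "z \<in> topspace X" "z \<notin> F" "jointly_nonseparated X (insert z F)"
      using jointly_nonseparated_extend[OF qcc assms(2-4)] F by blast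
    then have "?P (insert z F) \<and> F \<subset> insert z F"
      using F by blast
    then show ?thesis by blast
  qed
  ultimately obtain G :: "nat \<Rightarrow> 'a set"
    where G: "\<And>n. ?P (G n)" and less: "\<And>n. G n \<subset> G (Suc n)"
    using dependent_nat_choice[of "\<lambda>_. ?P" "\<lambda>_. (\<subset>)"] by metis
  have mono: "G m \<subseteq> G n" if "m \<le> n" for m n
    using lift_Suc_mono_le[of G] less that by blast
  have "pairwise (\<lambda>x y. \<not> separated_points X x y) (\<Union>n. G n)"
  proof (intro pairwiseI)
    fix x y assume "x \<in> (\<Union>n. G n)" "y \<in> (\<Union>n. G n)" "x \<noteq> y"
    then obtain m n where "x \<in> G m" "y \<in> G n" by blast
    then have "x \<in> G (max m n)" "y \<in> G (max m n)"
      using mono[of m "max m n"] mono[of n "max m n"] by auto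
    then show "\<not> separated_points X x y"
      using jointly_nonseparated_imp_not_separated G \<open>x \<noteq> y\<close> by metis
  qed
  moreover have "(\<Union>n. G n) \<subseteq> topspace X"
    using G by blast
  ultimately have "finite (\<Union>n. G n)"
    using pairwise_nonseparated_finite[OF qcc assms(3)] by blast
  \<comment> \<open>Each of the infinitely many sets \<open>G n\<close> is a subset of this union, and they are distinct.\<close>
  moreover have "range G \<subseteq> Pow (\<Union>n. G n)" by blast
  ultimately have "finite (range G)"
    using finite_subset by blast
  moreover have "inj G"
    using strict_mono_imp_inj_on[of G] less by (simp add: strict_mono_Suc_iff)
  ultimately show False
    using finite_imageD infinite_UNIV_nat by blast
qed

end
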